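(* There is a constant $C>0$ such that the following holds. For every integer $r\ge 3$ and every sufficiently large $n$, there is a balanced $r$-colouring of the edges of $K_n$ such that, for every tree $T$ on $n$ vertices with maximum degree $\Delta\ge 23n/24+C$ and every copy of $T$ in $K_n$, the number of edges in colour $1$ is at most the number of edges in some colour among $2,\dots,r$.
   Context: An $r$-colouring is an edge-colouring with colours in $\{1,\dots,r\}$. It is balanced if the numbers of edges in any two different colours differ by at most $1$. A copy of $T$ in $K_n$ is a subgraph of $K_n$ isomorphic to $T$. "Sufficiently large $n$" may depend on $r$; the constant $C$ does not. *)

theory Defs
  imports Complex_Main
begin

record 'a ugraph =
  uverts :: "'a set"
  uedges :: "'a set set"

definition simple_ugraph :: "'a ugraph \<Rightarrow> bool" where
  "simple_ugraph G \<longleftrightarrow>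
     finite (uverts G) \<and> (\<forall>e \<in> uedges G. e \<subseteq> uverts G \<and> card e = 2)"

definition complete_ugraph :: "nat \<Rightarrow> nat ugraph" where
  "complete_ugraph n = \<lparr> uverts = {..<n}, uedges = {e. e \<subseteq> {..<n} \<and> card e = 2} \<rparr>"

definition uadj :: "'a ugraph \<Rightarrow> 'a \<Rightarrow> 'a \<Rightarrow> bool" where
  "uadj G u v \<longleftrightarrow> {u, v} \<in> uedges G"

definition uconnected :: "'a ugraph \<Rightarrow> bool" where
  "uconnected G \<longleftrightarrow>
     uverts G \<noteq> {} \<and> (\<forall>u \<in> uverts G. \<forall>v \<in> uverts G. (uadj G)\<^sup>*\<^sup>* u v)"

(* A cycle is given by its distinct vertices in order; the edge closing it up is not
   repeated in the list. *)
definition ucycle :: "'a ugraph \<Rightarrow> 'a list \<Rightarrow> bool" where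
  "ucycle G p \<longleftrightarrow>
     3 \<le> length p \<and> distinct p \<and> successively (uadj G) p \<and> uadj G (last p) (hd p)"

definition utree :: "'a ugraph \<Rightarrow> bool" where
  "utree G \<longleftrightarrow> simple_ugraph G \<and> uconnected G \<and> (\<nexists>p. ucycle G p)"

definition udegree :: "'a ugraph \<Rightarrow> 'a \<Rightarrow> nat" where
  "udegree G v = card {e \<in> uedges G. v \<in> e}"

definition max_udegree :: "'a ugraph \<Rightarrow> nat" where
  "max_udegree G = Max (udegree G ` uverts G)"

definition usubgraph :: "'a ugraph \<Rightarrow> 'a ugraph \<Rightarrow> bool" where
  "usubgraph H G \<longleftrightarrow>
     simple_ugraph H \<and> uverts H \<subseteq> uverts G \<and> uedges H \<subseteq> uedges G"

definition uisomorphic :: "'a ugraph \<Rightarrow> 'b ugraph \<Rightarrow> bool" where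
  "uisomorphic G H \<longleftrightarrow>
     (\<exists>f. bij_betw f (uverts G) (uverts H) \<and>
       (\<forall>u \<in> uverts G. \<forall>v \<in> uverts G. uadj G u v \<longleftrightarrow> uadj H (f u) (f v)))"

definition ucopy :: "'a ugraph \<Rightarrow> 'b ugraph \<Rightarrow> 'a ugraph \<Rightarrow> bool" where
  "ucopy H T G \<longleftrightarrow> usubgraph H G \<and> uisomorphic T H"

(* Only the values of c on the edges of G matter. *)
definition edge_colouring :: "nat \<Rightarrow> 'a ugraph \<Rightarrow> ('a set \<Rightarrow> nat) \<Rightarrow> bool" where
  "edge_colouring r G c \<longleftrightarrow> (\<forall>e \<in> uedges G. c e \<in> {1..r})"

definition colour_count :: "('a set \<Rightarrow> nat) \<Rightarrow> 'a ugraph \<Rightarrow> nat \<Rightarrow> nat" where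
  "colour_count c G i = card {e \<in> uedges G. c e = i}"

definition balanced_colouring :: "nat \<Rightarrow> 'a ugraph \<Rightarrow> ('a set \<Rightarrow> nat) \<Rightarrow> bool" where
  "balanced_colouring r G c \<longleftrightarrow> edge_colouring r G c \<and>
     (\<forall>i \<in> {1..r}. \<forall>j \<in> {1..r}. colour_count c G i \<le> colour_count c G j + 1)"

end

theory Submission
  imports Defs
begin

text \<open>
  Put the vertices on a circle, let m = r - 1, and join u to u + t for t = 1, ..., D by an arc whose
  colour is determined by u mod m, where D is as large as the balance condition allows, about
  mn/(2r). The remaining edges, among them all edges of colour 1, are coloured arbitrarily so as to
  balance the classes. Every vertex v lies on 2D arcs, so it has at most n - 1 - 2D edges of
  colour 1, about n/r, while the colour of its own residue class occurs on the D arcs leaving v and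
  on about D/m of those entering it. For all r \<ge> 3 the latter exceeds the former by about n/6 or
  more. A copy of T differs from the full star at its vertex of degree \<Delta> by the removal and the
  addition of n - 1 - \<Delta> < n/24 edges each, which changes the difference by less than n/12.
\<close>

section \<open>Edge bound for acyclic graphs\<close>

text \<open>Take an end \<open>x\<close> of a longest path. A neighbour of \<open>x\<close> off the
  path would prolong it, and a neighbour at position 2 or later would close a cycle with the initial
  segment, so only the next vertex on the path can be adjacent to \<open>x\<close>.\<close>

lemma acyclic_low_degree_vertex:
  assumes G: "simple_ugraph G" and ne: "uverts G \<noteq> {}" and acyc: "\<nexists>p. ucycle G p"
  obtains x where "x \<in> uverts G" "udegree G x \<le> 1"
proof -
  have fin: "finite (uverts G)" and edge: "\<And>e. e \<in> uedges G \<Longrightarrow> e \<subseteq> uverts G \<and> card e = 2"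
    using G by (auto simp: simple_ugraph_def)
  define path where "path p \<longleftrightarrow>
    p \<noteq> [] \<and> distinct p \<and> set p \<subseteq> uverts G \<and> successively (uadj G) p" for p
  obtain v where "v \<in> uverts G" using ne by blast
  then have "path [v]" by (simp add: path_def)
  moreover have "\<forall>p. path p \<longrightarrow> length p \<le> card (uverts G)"
    unfolding path_def using fin by (auto simp flip: distinct_card intro: card_mono)
  ultimately obtain p where p: "path p" and longest: "\<And>q. path q \<Longrightarrow> length q \<le> length p"
    using ex_has_greatest_nat[of path "[v]" length "Suc (card (uverts G))"]
    by (auto simp: less_Suc_eq_le)
  define x where "x = hd p"
  have p_props: "p \<noteq> []" "distinct p" "set p \<subseteq> uverts G" "successively (uadj G) p"
    using p by (auto simp: path_def)
  have x0: "x = p ! 0" using p_props(1) by (simp add: x_def hd_conv_nth)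
  have neighbour: "y = p ! 1" if xy: "{x, y} \<in> uedges G" for y
  proof -
    have "y \<noteq> x" using edge[OF xy] by auto
    have y: "y \<in> uverts G" using edge[OF xy] by auto
    have "y \<in> set p"
    proof (rule ccontr)
      assume "y \<notin> set p"
      then have "path (y # p)"
        using p_props y xy by (auto simp: path_def successively_Cons uadj_def x_def insert_commute)
      then show False using longest by fastforce
    qed
    then obtain i where i: "i < length p" "y = p ! i" by (auto simp: in_set_conv_nth)
    have "i \<noteq> 0" using \<open>y \<noteq> x\<close> i x0 by metis
    moreover have "\<not> i \<ge> 2"
    proof
      assume "i \<ge> 2"
      let ?c = "take (Suc i) p"
      have "successively (uadj G) (?c @ drop (Suc i) p)" using p_props by simp
      then have "successively (uadj G) ?c" unfolding successively_append_iff by blast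
      moreover have "last ?c = y" using i by (simp add: take_Suc_conv_app_nth)
      moreover have "hd ?c = x" by (simp add: x_def)
      ultimately have "ucycle G ?c"
        using i \<open>i \<ge> 2\<close> p_props xy by (auto simp: ucycle_def uadj_def insert_commute)
      then show False using acyc by blast
    qed
    ultimately have "i = 1" by linarith
    then show ?thesis using i by simp
  qed
  \<comment> \<open>If \<open>p\<close> consists of \<open>x\<close> alone, \<open>p ! 1\<close> is
    unspecified; \<open>x\<close> then has no neighbour and the left side is empty.\<close>
  have "{e \<in> uedges G. x \<in> e} \<subseteq> {{x, p ! 1}}"
  proof clarify
    fix e assume e: "e \<in> uedges G" "x \<in> e"
    then obtain y where "e = {x, y}" using edge[OF e(1)] by (auto simp: card_2_iff)
    then show "e = {x, p ! 1}" using neighbour e by blast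
  qed
  then have "udegree G x \<le> 1"
    unfolding udegree_def using card_mono[of "{{x, p ! 1}}"] by fastforce
  moreover have "x \<in> uverts G" using p_props by (auto simp: x_def)
  ultimately show thesis using that by blast
qed

lemma finite_uedges: "simple_ugraph G \<Longrightarrow> finite (uedges G)"
  unfolding simple_ugraph_def by (rule finite_subset[of _ "Pow (uverts G)"]) auto

text \<open>Deleting a vertex of degree at most 1 costs at most one edge and keeps the graph
  acyclic, so the induction runs over forests. For a copy of \<open>T\<close> this leaves at most
  \<open>n - 1 - \<Delta>\<close> edges away from a vertex of degree
  \<open>\<Delta>\<close>.\<close>

lemma acyclic_card_uedges:
  assumes "simple_ugraph G" "uverts G \<noteq> {}" "\<nexists>p. ucycle G p"
  shows "card (uedges G) + 1 \<le> card (uverts G)"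
  using assms
proof (induction "card (uverts G)" arbitrary: G rule: less_induct)
  case less
  have fin: "finite (uverts G)" using less.prems by (simp add: simple_ugraph_def)
  obtain x where x: "x \<in> uverts G" "udegree G x \<le> 1"
    using acyclic_low_degree_vertex less.prems by blast
  define G' where "G' = \<lparr> uverts = uverts G - {x}, uedges = {e \<in> uedges G. x \<notin> e} \<rparr>"
  have split: "uedges G = uedges G' \<union> {e \<in> uedges G. x \<in> e}" by (auto simp: G'_def)
  have "card (uedges G) \<le> card (uedges G') + udegree G x"
    unfolding udegree_def by (subst split) (rule card_Un_le)
  then have le: "card (uedges G) \<le> card (uedges G') + 1" using x by simp
  have card: "card (uverts G) = card (uverts G') + 1"
    using x fin by (simp add: G'_def) (metis Suc_pred card_gt_0_iff empty_iff)
  have simple: "simple_ugraph G'" using less.prems(1) by (auto simp: simple_ugraph_def G'_def)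
  show ?case
  \<comment> \<open>The bound fails for the empty graph, so a single vertex is treated
    separately.\<close>
  proof (cases "uverts G' = {}")
    case True
    have "uedges G = {}"
    proof (rule equals0I)
      fix e assume "e \<in> uedges G"
      then have "e \<subseteq> {x}" "card e = 2"
        using less.prems(1) True by (auto simp: simple_ugraph_def G'_def)
      then show False using card_mono[of "{x}" e] by simp
    qed
    then show ?thesis using card by simp
  next
    case False
    have "\<nexists>p. ucycle G' p"
    proof
      assume "\<exists>p. ucycle G' p"
      then obtain p where "ucycle G' p" by blast
      moreover have "uadj G' a b \<Longrightarrow> uadj G a b" for a b by (auto simp: uadj_def G'_def)
      ultimately have "ucycle G p"
        unfolding ucycle_def by (auto intro: successively_mono)
      then show False using less.prems(3) by blast
    qed
    then show ?thesis using less.hyps[of G'] simple False card le by simp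
  qed
qed

section \<open>Copies, stars and complete graphs\<close>

text \<open>Isomorphism is defined by adjacency of vertices, while the argument counts edges. The
  image map of \<open>f\<close> on vertex sets carries edges to edges; it is injective on them
  because edges are subsets of \<open>uverts T\<close>, where \<open>f\<close> is injective.\<close>

lemma uisomorphic_uedges:
  assumes T: "simple_ugraph T" and H: "simple_ugraph H"
    and bij: "bij_betw f (uverts T) (uverts H)"
    and adj: "\<And>u v. u \<in> uverts T \<Longrightarrow> v \<in> uverts T \<Longrightarrow> uadj T u v \<longleftrightarrow> uadj H (f u) (f v)"
  shows "bij_betw ((`) f) (uedges T) (uedges H)"
    and "\<And>v. v \<in> uverts T \<Longrightarrow> udegree H (f v) = udegree T v"
proof -
  have inj: "inj_on f (uverts T)" and im: "f ` uverts T = uverts H"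
    using bij by (auto simp: bij_betw_def)
  have sub: "uedges T \<subseteq> Pow (uverts T)" using T by (auto simp: simple_ugraph_def)
  have inj_im: "inj_on ((`) f) (uedges T)"
    using inj_on_image_Pow[OF inj] sub by (rule inj_on_subset)
  have "(`) f ` uedges T = uedges H"
  proof (intro equalityI subsetI)
    fix e assume "e \<in> (`) f ` uedges T"
    then obtain d where d: "d \<in> uedges T" "e = f ` d" by blast
    then have "d \<subseteq> uverts T" "card d = 2" using T by (auto simp: simple_ugraph_def)
    then obtain u v where "d = {u, v}" "u \<in> uverts T" "v \<in> uverts T"
      by (metis card_2_iff insert_subset)
    then show "e \<in> uedges H" using d adj[of u v] by (auto simp: uadj_def)
  next
    fix e assume e: "e \<in> uedges H"
    then have "e \<subseteq> uverts H" "card e = 2" using H by (auto simp: simple_ugraph_def)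
    then obtain a b where ab: "e = {a, b}" "a \<in> uverts H" "b \<in> uverts H"
      by (metis card_2_iff insert_subset)
    from ab(2,3) obtain u v where "a = f u" "b = f v" "u \<in> uverts T" "v \<in> uverts T"
      unfolding im[symmetric] by (elim imageE)
    with ab(1) have "{u, v} \<in> uedges T" "e = f ` {u, v}" using e adj[of u v] by (auto simp: uadj_def)
    then show "e \<in> (`) f ` uedges T" by blast
  qed
  with inj_im show bijE: "bij_betw ((`) f) (uedges T) (uedges H)" by (simp add: bij_betw_def)
  show "udegree H (f v) = udegree T v" if v: "v \<in> uverts T" for v
  proof -
    have "{e \<in> uedges H. f v \<in> e} = (`) f ` {e \<in> uedges T. v \<in> e}"
    proof -
      have "f v \<in> f ` e \<longleftrightarrow> v \<in> e" if "e \<in> uedges T" for e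
        using inj_on_image_mem_iff[OF inj v] sub that by blast
      then show ?thesis unfolding bij_betw_imp_surj_on[OF bijE, symmetric] by blast
    qed
    moreover have "inj_on ((`) f) {e \<in> uedges T. v \<in> e}"
      using inj_im by (rule inj_on_subset) auto
    ultimately show ?thesis unfolding udegree_def by (simp add: card_image)
  qed
qed

text \<open>Compare \<open>H\<close> with the full star of \<open>G\<close> at \<open>v\<close>.
  \<open>H\<close> arises from that star by removing the star edges missing in \<open>H\<close> and
  adding the edges of \<open>H\<close> that avoid \<open>v\<close>; in the worst case all added
  edges have colour \<open>i\<close> and all removed ones have colour \<open>j\<close>.\<close>

lemma colour_counts_near_star:
  assumes H: "simple_ugraph H" "uverts H \<subseteq> uverts G" "uedges H \<subseteq> uedges G"
    and G: "simple_ugraph G"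
  shows "colour_count c H i \<le> card {e \<in> uedges G. v \<in> e \<and> c e = i} + (card (uedges H) - udegree H v)"
    and "card {e \<in> uedges G. v \<in> e \<and> c e = j} \<le> colour_count c H j + (udegree G v - udegree H v)"
proof -
  have finH: "finite (uedges H)" and finG: "finite (uedges G)" using H G by (auto intro: finite_uedges)
  let ?S = "{e \<in> uedges H. v \<in> e}"
  have "card (uedges H - ?S) = card (uedges H) - udegree H v"
    unfolding udegree_def by (rule card_Diff_subset) (use finH in auto)
  moreover have "card {e \<in> uedges H. c e = i}
      \<le> card {e \<in> uedges G. v \<in> e \<and> c e = i} + card (uedges H - ?S)"
    by (rule order_trans[OF card_mono card_Un_le]) (use finH finG H in auto)
  ultimately show "colour_count c H i
      \<le> card {e \<in> uedges G. v \<in> e \<and> c e = i} + (card (uedges H) - udegree H v)"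
    by (simp add: colour_count_def)
  have "card ({e \<in> uedges G. v \<in> e} - ?S) = udegree G v - udegree H v"
    unfolding udegree_def by (rule card_Diff_subset) (use finH H in auto)
  moreover have "card {e \<in> uedges G. v \<in> e \<and> c e = j}
      \<le> card {e \<in> uedges H. c e = j} + card ({e \<in> uedges G. v \<in> e} - ?S)"
    by (rule order_trans[OF card_mono card_Un_le]) (use finH finG H in auto)
  ultimately show "card {e \<in> uedges G. v \<in> e \<and> c e = j}
      \<le> colour_count c H j + (udegree G v - udegree H v)"
    by (simp add: colour_count_def)
qed

lemma simple_complete_ugraph: "simple_ugraph (complete_ugraph n)"
  by (auto simp: simple_ugraph_def complete_ugraph_def)

lemma card_uedges_complete_ugraph: "card (uedges (complete_ugraph n)) = n * (n - 1) div 2"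
  by (simp add: complete_ugraph_def n_subsets choose_two)

lemma udegree_complete_ugraph:
  assumes "v < n" shows "udegree (complete_ugraph n) v = n - 1"
proof -
  have "{e \<in> uedges (complete_ugraph n). v \<in> e} = (\<lambda>u. {v, u}) ` ({..<n} - {v})"
    using assms by (auto simp: complete_ugraph_def card_2_iff)
  moreover have "inj_on (\<lambda>u. {v, u}) ({..<n} - {v})" by (auto simp: inj_on_def doubleton_eq_iff)
  ultimately show ?thesis unfolding udegree_def using assms by (simp add: card_image)
qed

section \<open>Completing a partial colouring to a balanced one\<close>

text \<open>Greedy: the edges outside \<open>F\<close> are coloured one at a time, each with any
  colour whose class is not yet full.\<close>

lemma extend_capacitated_colouring:
  assumes "finite E" "F \<subseteq> E" "c0 ` F \<subseteq> I" "finite I"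
    and "\<And>i. i \<in> I \<Longrightarrow> card {e \<in> F. c0 e = i} \<le> s i" and "card E \<le> sum s I"
  obtains c where "\<And>e. e \<in> F \<Longrightarrow> c e = c0 e" "c ` E \<subseteq> I"
    "\<And>i. i \<in> I \<Longrightarrow> card {e \<in> E. c e = i} \<le> s i"
proof -
  have "\<exists>c. (\<forall>e\<in>F. c e = c0 e) \<and> c ` (F \<union> A) \<subseteq> I \<and> (\<forall>i\<in>I. card {e \<in> F \<union> A. c e = i} \<le> s i)"
    if "finite A" "A \<subseteq> E - F" for A
    using that
  proof (induction A rule: finite_induct)
    case empty
    then show ?case using assms by (intro exI[of _ c0]) auto
  next
    case (insert x A)
    then have "A \<subseteq> E - F" by simp
    from insert.IH[OF this] obtain c where c: "\<forall>e\<in>F. c e = c0 e" "c ` (F \<union> A) \<subseteq> I"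
      "\<forall>i\<in>I. card {e \<in> F \<union> A. c e = i} \<le> s i" by blast
    have finFA: "finite (F \<union> A)" using insert.hyps assms(1,2) finite_subset by blast
    have x: "x \<in> E" "x \<notin> F \<union> A" using insert.hyps insert.prems by auto
    have "(\<Sum>i\<in>I. card {e \<in> F \<union> A. c e = i}) = card (F \<union> A)"
      using sum.group[OF finFA \<open>finite I\<close> c(2), of "\<lambda>_. 1::nat"] by simp
    also have "\<dots> < card E"
      using x insert.prems assms(1,2) by (intro psubset_card_mono) auto
    \<comment> \<open>If every class were full, the edges coloured so far would number at least
      \<open>sum s I\<close>, hence at least \<open>card E\<close>, although \<open>x\<close> is
      still uncoloured.\<close>
    finally have "\<not> (\<forall>i\<in>I. s i \<le> card {e \<in> F \<union> A. c e = i})"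
      using assms(6) sum_mono[of I s "\<lambda>i. card {e \<in> F \<union> A. c e = i}"] by fastforce
    then obtain k where k: "k \<in> I" "card {e \<in> F \<union> A. c e = k} < s k" by auto
    have cls: "{e \<in> F \<union> insert x A. (c(x := k)) e = i} =
        (if i = k then insert x {e \<in> F \<union> A. c e = i} else {e \<in> F \<union> A. c e = i})" for i
      using x by auto
    have "\<forall>i\<in>I. card {e \<in> F \<union> insert x A. (c(x := k)) e = i} \<le> s i"
      unfolding cls using k c(3) finFA x by (auto simp: card_insert_if)
    then show ?case using c k x by (intro exI[of _ "c(x := k)"]) auto
  qed
  moreover have "F \<union> (E - F) = E" using assms(2) by blast
  ultimately obtain c where "\<forall>e\<in>F. c e = c0 e" "c ` E \<subseteq> I"
    "\<forall>i\<in>I. card {e \<in> E. c e = i} \<le> s i"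
    using assms(1) by (metis finite_Diff order_refl)
  then show thesis using that[of c] by blast
qed

text \<open>Capacities that differ by at most 1 and add up to exactly \<open>card E\<close> must all
  be attained, so respecting them already gives balance.\<close>

lemma extend_balanced_colouring:
  assumes E: "finite E" and F: "F \<subseteq> E" "c0 ` F \<subseteq> {1..r}" and r: "r > 0"
    and cap: "\<And>i. i \<in> {1..r} \<Longrightarrow> card {e \<in> F. c0 e = i} \<le> card E div r"
  obtains c where "\<And>e. e \<in> F \<Longrightarrow> c e = c0 e" "c ` E \<subseteq> {1..r}"
    "\<And>i j. i \<in> {1..r} \<Longrightarrow> j \<in> {1..r} \<Longrightarrow> card {e \<in> E. c e = i} \<le> card {e \<in> E. c e = j} + 1"
proof -
  define q where "q = card E div r"
  \<comment> \<open>The first \<open>card E mod r\<close> colours absorb the remainder of the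
    division by \<open>r\<close>.\<close>
  define s where "s i = q + (if i \<le> card E mod r then 1 else 0)" for i
  have "{1..r} \<inter> {i. i \<le> card E mod r} = {1..card E mod r}"
    using mod_less_divisor[OF r, of "card E"] by auto
  then have sum: "sum s {1..r} = card E"
    unfolding s_def sum.distrib q_def by (simp add: sum.If_cases)
  obtain c where c: "\<And>e. e \<in> F \<Longrightarrow> c e = c0 e" "c ` E \<subseteq> {1..r}"
    "\<And>i. i \<in> {1..r} \<Longrightarrow> card {e \<in> E. c e = i} \<le> s i"
    using extend_capacitated_colouring[OF E F, of s] cap sum
    by (auto simp: s_def q_def trans_le_add1)
  have "(\<Sum>i\<in>{1..r}. card {e \<in> E. c e = i}) = sum s {1..r}"
    using sum.group[OF E _ c(2), of "\<lambda>_. 1::nat"] sum by simp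
  then have "card {e \<in> E. c e = i} = s i" if "i \<in> {1..r}" for i
    using sum_mono_inv[of "\<lambda>i. card {e \<in> E. c e = i}" "{1..r}" s i] c(3) that by auto
  then show thesis using that[OF c(1,2)] by (auto simp: s_def)
qed

section \<open>Residue classes in intervals\<close>

lemma card_residue_class_le: "card {u \<in> {..<n}. u mod m = k} \<le> n div m + (1::nat)"
proof -
  have "inj_on (\<lambda>u. u div m) {u \<in> {..<n}. u mod m = k}"
    by (auto simp: inj_on_def) (metis div_mult_mod_eq)
  moreover have "(\<lambda>u. u div m) ` {u \<in> {..<n}. u mod m = k} \<subseteq> {..n div m}"
    by (auto intro: div_le_mono)
  ultimately have "card {u \<in> {..<n}. u mod m = k} \<le> card {..n div m}"
    by (intro card_inj_on_le) auto
  then show ?thesis by simp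
qed

lemma card_residue_class_ge:
  fixes m :: nat
  assumes "k < m"
  shows "(b - a) div m \<le> card {t \<in> {a<..b}. t mod m = k}"
proof -
  \<comment> \<open>\<open>a + 1 + s\<close> is the least number above \<open>a\<close> with residue
    \<open>k\<close>; since \<open>s < m\<close>, each full block of \<open>m\<close> numbers after
    \<open>a\<close> contains one further term of the progression.\<close>
  define s where "s = (k + (m - (a + 1) mod m)) mod m"
  have m: "m > 0" using assms by simp
  have s: "s < m" unfolding s_def using m by simp
  have "(a + 1 + s) mod m = ((a + 1) mod m + (k + (m - (a + 1) mod m))) mod m"
    unfolding s_def by (simp only: mod_add_left_eq mod_add_right_eq)
  also have "\<dots> = (k + m) mod m"
    using mod_less_divisor[OF m, of "a + 1"] by (simp add: algebra_simps)
  finally have res: "(a + 1 + s) mod m = k" using assms by simp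
  let ?g = "\<lambda>i. a + 1 + s + i * m"
  have "inj_on ?g {..<(b - a) div m}" using m by (auto simp: inj_on_def)
  moreover have "?g ` {..<(b - a) div m} \<subseteq> {t \<in> {a<..b}. t mod m = k}"
  proof clarify
    fix i assume "i < (b - a) div m"
    then have "(i + 1) * m \<le> (b - a) div m * m" by (intro mult_le_mono1) simp
    also have "\<dots> \<le> b - a" by simp
    finally have "i * m + m \<le> b - a" by simp
    moreover have "?g i mod m = k" using res by simp
    ultimately show "?g i \<in> {a<..b} \<and> ?g i mod m = k" using s m by auto
  qed
  ultimately have "card {..<(b - a) div m} \<le> card {t \<in> {a<..b}. t mod m = k}"
    by (intro card_inj_on_le) auto
  then show ?thesis by simp
qed

section \<open>Arcs on the circle\<close>

text \<open>The pair is a source and a length; the other end is \<open>u + t\<close> modulo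
  \<open>n\<close>. For \<open>u < n\<close> and \<open>t \<le> n\<close> one subtraction performs
  the reduction, which keeps the case analysis linear.\<close>

definition arc :: "nat \<Rightarrow> nat \<times> nat \<Rightarrow> nat set" where
  "arc n = (\<lambda>(u, t). {u, if u + t < n then u + t else u + t - n})"

text \<open>Two codes of one edge with different sources would traverse it in opposite directions,
  so their lengths would add up to \<open>n\<close>; but both are at most \<open>D\<close>.\<close>

lemma inj_on_arc: "2 * D < n \<Longrightarrow> inj_on (arc n) ({..<n} \<times> {1..D})"
  unfolding inj_on_def arc_def
  by (auto simp: doubleton_eq_iff split: if_splits)

lemma arc_in_complete_ugraph:
  "2 * D < n \<Longrightarrow> arc n ` ({..<n} \<times> {1..D}) \<subseteq> uedges (complete_ugraph n)"
  by (auto simp: arc_def complete_ugraph_def card_insert_if)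

lemma source_in_arc: "u \<in> arc n (u, t)"
  by (simp add: arc_def)

text \<open>This is \<open>v - t\<close> modulo \<open>n\<close>, the start of the arc of length
  \<open>t\<close> that enters \<open>v\<close>.\<close>

definition arc_source :: "nat \<Rightarrow> nat \<Rightarrow> nat \<Rightarrow> nat" where
  "arc_source n v t = (if t \<le> v then v - t else v + n - t)"

lemma arc_source:
  assumes "v < n" "t \<in> {1..D}" "2 * D < n"
  shows "arc_source n v t < n" "arc_source n v t \<noteq> v" "v \<in> arc n (arc_source n v t, t)"
  using assms by (auto simp: arc_source_def arc_def)

text \<open>The \<open>D\<close> arcs leaving \<open>v\<close> and one entering arc for each length
  in \<open>Z\<close> are distinct, because an entering arc has a source other than
  \<open>v\<close>. All lengths are used to bound colour 1, selected ones for the colour of the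
  class of \<open>v\<close>.\<close>

lemma card_arcs_at_ge:
  assumes n: "2 * D < n" and v: "v < n" and Z: "Z \<subseteq> {1..D}"
  shows "D + card Z \<le>
    card {a \<in> {..<n} \<times> {1..D}. v \<in> arc n a \<and> (fst a = v \<or> snd a \<in> Z)}" (is "_ \<le> card ?A")
proof -
  let ?O = "Pair v ` {1..D}" and ?I = "(\<lambda>t. (arc_source n v t, t)) ` Z"
  have fin: "finite Z" using Z finite_subset by blast
  have src: "arc_source n v t < n" "v \<noteq> arc_source n v t" "v \<in> arc n (arc_source n v t, t)"
    if "t \<in> Z" for t
    using arc_source[OF v _ n, of t] Z that by auto
  have "card ?O = D" by (simp add: card_image inj_on_def)
  moreover have "card ?I = card Z" by (simp add: card_image inj_on_def)
  moreover have "card (?O \<union> ?I) = card ?O + card ?I"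
    using src(2) fin by (intro card_Un_disjoint) blast+
  moreover have "card (?O \<union> ?I) \<le> card ?A"
  proof (rule card_mono)
    show "finite ?A" by simp
    have "?O \<subseteq> ?A" using v by (auto simp: source_in_arc)
    moreover have "?I \<subseteq> ?A" using src Z by auto
    ultimately show "?O \<union> ?I \<subseteq> ?A" by blast
  qed
  ultimately show ?thesis by linarith
qed

text \<open>All arcs leaving \<open>v\<close> count. An entering arc of length \<open>t\<close> has
  source \<open>v - t\<close>, or \<open>v + n - t\<close> if it passes the origin, so it counts
  when \<open>t\<close> is congruent to 0 or to \<open>n\<close> modulo \<open>m\<close>,
  respectively; each of these is a residue class in an interval.\<close>

lemma card_same_class_arcs_at:
  assumes n: "2 * D < n" and v: "v < n" and m: "m > 0"
  shows "D + D div m \<le> card {a \<in> {..<n} \<times> {1..D}. v \<in> arc n a \<and> fst a mod m = v mod m} + 1"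
    (is "_ \<le> card ?A + 1")
proof -
  \<comment> \<open>Lengths up to \<open>w\<close> do not pass the origin; those from
    \<open>w + 1\<close> to \<open>D\<close> do.\<close>
  define w where "w = min v D"
  let ?X = "{t \<in> {0<..w}. t mod m = 0}" and ?Y = "{t \<in> {w<..D}. t mod m = n mod m}"
  define Z where "Z = ?X \<union> ?Y"
  have Z: "Z \<subseteq> {1..D}" by (auto simp: w_def Z_def)
  have cong: "arc_source n v t mod m = v mod m" if "t \<in> Z" for t
  proof (cases "t \<le> v")
    case True
    then have "t mod m = 0" using that by (auto simp: w_def Z_def)
    moreover have "v mod m = (v - t + t) mod m" using True by simp
    ultimately show ?thesis using True
      by (metis arc_source_def add.right_neutral mod_add_right_eq)
  next
    case False
    then have t: "t mod m = n mod m" "t \<le> n" using that n by (auto simp: w_def Z_def)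
    then obtain d where "n - t = m * d" using mod_eq_dvd_iff_nat[of t n m] by (metis dvdE)
    moreover have "arc_source n v t = v + (n - t)" using False t by (simp add: arc_source_def)
    ultimately show ?thesis by simp
  qed
  \<comment> \<open>Cutting the interval of lengths in two loses at most one multiple of
    \<open>m\<close>; this is the 1 in the conclusion.\<close>
  have "D div m \<le> w div m + (D - w) div m + 1"
  proof -
    have "w \<le> D" by (simp add: w_def)
    then have "D < (w div m + (D - w) div m + 2) * m"
      using dividend_less_div_times[OF m, of w] dividend_less_div_times[OF m, of "D - w"]
      unfolding distrib_right by linarith
    from less_mult_imp_div_less[OF this] show ?thesis by linarith
  qed
  also have "\<dots> \<le> card ?X + card ?Y + 1"
    using card_residue_class_ge[of 0 m w 0] card_residue_class_ge[of "n mod m" m D w] m by simp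
  also have "card ?X + card ?Y = card Z"
    unfolding Z_def by (rule card_Un_disjoint[symmetric]) auto
  finally have "D + D div m \<le> D + card Z + 1" by simp
  also have "D + card Z \<le> card ?A"
  proof (rule order_trans[OF card_arcs_at_ge[OF n v Z] card_mono])
    show "{a \<in> {..<n} \<times> {1..D}. v \<in> arc n a \<and> (fst a = v \<or> snd a \<in> Z)} \<subseteq> ?A"
    proof clarify
      fix u t assume ut: "u < n" "t \<in> {1..D}" "v \<in> arc n (u, t)" "fst (u, t) = v \<or> snd (u, t) \<in> Z"
      then have "u = v \<or> u = arc_source n v t \<and> t \<in> Z"
        using n by (auto simp: arc_def arc_source_def split: if_splits)
      then have "u mod m = v mod m" using cong by auto
      with ut show "(u, t) \<in> {..<n} \<times> {1..D} \<and> v \<in> arc n (u, t) \<and> fst (u, t) mod m = v mod m"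
        by simp
    qed
  qed simp
  finally show ?thesis by simp
qed

lemma card_le_card_arc_image:
  assumes "2 * D < n" "A \<subseteq> {..<n} \<times> {1..D}" "finite B" "arc n ` A \<subseteq> B"
  shows "card A \<le> card B"
  using card_inj_on_le[OF inj_on_subset[OF inj_on_arc]] assms by blast

section \<open>The circulant colouring and its arc length\<close>

text \<open>A residue class has at most \<open>n div m + 1\<close> sources with \<open>D\<close>
  arcs each, so the assumption on \<open>D\<close> lets every arc class fit below the balanced size
  and the colouring extends. No arc has colour 1, and the arcs from sources congruent to
  \<open>v\<close> share the colour \<open>v mod m + 2\<close>.\<close>

lemma circulant_colouring:
  fixes n m D :: nat
  assumes n: "2 * D < n" and m: "m > 0"
    and D: "(n div m + 1) * D \<le> (n * (n - 1) div 2) div (m + 1)"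
  obtains c where "balanced_colouring (m + 1) (complete_ugraph n) c"
    "\<And>v. v < n \<Longrightarrow> card {e \<in> uedges (complete_ugraph n). v \<in> e \<and> c e = 1} + 2 * D \<le> n - 1"
    "\<And>v. v < n \<Longrightarrow> D + D div m \<le>
       card {e \<in> uedges (complete_ugraph n). v \<in> e \<and> c e = v mod m + 2} + 1"
proof -
  let ?E = "uedges (complete_ugraph n)"
  define P where "P = {..<n} \<times> {1..D}"
  \<comment> \<open>The shift by 2 reserves colour 1 for edges that are not arcs. Values of
    \<open>c0\<close> off the arcs are arbitrary and get overwritten.\<close>
  define c0 where "c0 e = fst (inv_into P (arc n) e) mod m + 2" for e
  have finE: "finite ?E" by (rule finite_uedges[OF simple_complete_ugraph])
  have inj: "inj_on (arc n) P" unfolding P_def by (rule inj_on_arc[OF n])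
  have c0: "c0 (arc n a) = fst a mod m + 2" if "a \<in> P" for a
    unfolding c0_def by (simp add: inv_into_f_f[OF inj that])
  have sub: "arc n ` P \<subseteq> ?E" unfolding P_def by (rule arc_in_complete_ugraph[OF n])
  have range: "c0 ` arc n ` P \<subseteq> {1..m + 1}"
  proof clarify
    fix a assume "a \<in> P"
    then show "c0 (arc n a) \<in> {1..m + 1}"
      using c0[of a] mod_less_divisor[OF m, of "fst a"] by simp
  qed
  have cap: "card {e \<in> arc n ` P. c0 e = i} \<le> card ?E div (m + 1)" for i
  proof -
    \<comment> \<open>For \<open>i < 2\<close> the subtraction truncates, but then no arc has colour
      \<open>i\<close> and the inclusion is trivial.\<close>
    let ?U = "{u \<in> {..<n}. u mod m = i - 2}"
    have "{e \<in> arc n ` P. c0 e = i} \<subseteq> arc n ` (?U \<times> {1..D})"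
    proof
      fix e assume "e \<in> {e \<in> arc n ` P. c0 e = i}"
      then obtain a where "a \<in> P" "e = arc n a" "c0 (arc n a) = i" by blast
      then show "e \<in> arc n ` (?U \<times> {1..D})"
        using c0[of a] by (auto simp: P_def)
    qed
    then have "card {e \<in> arc n ` P. c0 e = i} \<le> card (?U \<times> {1..D})"
      by (rule surj_card_le[rotated]) simp
    also have "\<dots> \<le> (n div m + 1) * D"
      using mult_le_mono1[OF card_residue_class_le[of n m "i - 2"], of D]
      by (simp only: card_cartesian_product card_atLeastAtMost) simp
    finally show ?thesis using D by (simp add: card_uedges_complete_ugraph)
  qed
  obtain c where c: "\<And>e. e \<in> arc n ` P \<Longrightarrow> c e = c0 e" "c ` ?E \<subseteq> {1..m + 1}"
    "\<And>i j. i \<in> {1..m + 1} \<Longrightarrow> j \<in> {1..m + 1} \<Longrightarrow> card {e \<in> ?E. c e = i} \<le> card {e \<in> ?E. c e = j} + 1"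
    using extend_balanced_colouring[OF finE sub range _ cap] by auto
  have c_arc: "c (arc n a) = fst a mod m + 2" if "a \<in> P" for a
    using c(1) c0 that by simp
  show thesis
  proof (rule that)
    show "balanced_colouring (m + 1) (complete_ugraph n) c"
      unfolding balanced_colouring_def edge_colouring_def colour_count_def
      using c(2,3) by blast
  next
    fix v assume v: "v < n"
    let ?S = "{e \<in> ?E. v \<in> e}"
    have "2 * D \<le> card {a \<in> P. v \<in> arc n a \<and> (fst a = v \<or> snd a \<in> {1..D})}"
      using card_arcs_at_ge[OF n v order_refl] by (simp add: P_def)
    also have "\<dots> \<le> card {e \<in> ?S. c e \<noteq> 1}"
      by (rule card_le_card_arc_image[OF n]) (use finE sub c_arc in \<open>auto simp: P_def\<close>)
    finally have "card {e \<in> ?S. c e = 1} + 2 * D \<le> card {e \<in> ?S. c e = 1} + card {e \<in> ?S. c e \<noteq> 1}"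
      by simp
    also have "\<dots> = card ({e \<in> ?S. c e = 1} \<union> {e \<in> ?S. c e \<noteq> 1})"
      by (rule card_Un_disjoint[symmetric]) (use finE in auto)
    also have "{e \<in> ?S. c e = 1} \<union> {e \<in> ?S. c e \<noteq> 1} = ?S" by auto
    also have "card ?S = n - 1" using udegree_complete_ugraph[OF v] by (simp add: udegree_def)
    finally show "card {e \<in> ?E. v \<in> e \<and> c e = 1} + 2 * D \<le> n - 1" by simp
  next
    fix v assume v: "v < n"
    have "card {a \<in> P. v \<in> arc n a \<and> fst a mod m = v mod m}
        \<le> card {e \<in> ?E. v \<in> e \<and> c e = v mod m + 2}"
      by (rule card_le_card_arc_image[OF n]) (use finE sub c_arc in \<open>auto simp: P_def\<close>)
    then show "D + D div m \<le> card {e \<in> ?E. v \<in> e \<and> c e = v mod m + 2} + 1"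
      using card_same_class_arcs_at[OF n v m] unfolding P_def by linarith
  qed
qed

text \<open>Taking \<open>D\<close> as large as the capacity permits gives about
  \<open>m * n / (2 * (m + 1))\<close>, so \<open>3 * D + D / m\<close> is about
  \<open>(3 * m + 1) * n / (2 * (m + 1))\<close>. That coefficient increases with \<open>m\<close>
  and equals 7/6 at \<open>m = 2\<close>; the remaining terms absorb the roundings.\<close>

lemma circulant_degree_choice:
  fixes n m :: nat
  assumes m: "m \<ge> 2" and n: "n \<ge> 21 * m + 96"
  obtains D where "2 * D < n" "(n div m + 1) * D \<le> (n * (n - 1) div 2) div (m + 1)"
    "7 * real n / 6 \<le> 3 * real D + real D / real m + 7 * real m / 4 + 7"
proof -
  define E where "E = n * (n - 1) div 2"
  define q where "q = E div (m + 1)"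
  define b where "b = n div m + 1"
  define D where "D = q div b"
  have r1: "real (n - 1) = real n - 1" using n by simp
  have mpos: "real m > 0" and npos: "real n > 0" using m n by auto
  have Dq: "b * D \<le> q" by (simp add: D_def)
  have E: "real E = real n * (real n - 1) / 2"
    using r1 unfolding E_def by (subst real_of_nat_div) (auto simp: even_mult_iff)
  have q_le: "real q * (2 * (real m + 1)) \<le> real n * (real n - 1)"
  proof -
    have "q * (m + 1) \<le> E" unfolding q_def by (rule div_times_less_eq_dividend)
    then have "real (q * (m + 1)) \<le> real E" by (simp only: of_nat_le_iff)
    then show ?thesis by (simp add: E algebra_simps)
  qed
  have q_ge: "real n * (real n - 1) < (real q + 1) * (2 * (real m + 1))"
  proof -
    have "E < m + 1 + q * (m + 1)" unfolding q_def by (rule dividend_less_div_times) simp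
    then have "E < (q + 1) * (m + 1)" by simp
    then have "real E < real ((q + 1) * (m + 1))" by (simp only: of_nat_less_iff)
    then show ?thesis by (simp add: E algebra_simps)
  qed
  have "n < b * m" using dividend_less_div_times[of m n] m by (simp add: b_def)
  then have b_ge: "real n < real b * real m" by (simp only: of_nat_less_iff flip: of_nat_mult)
  have b_le: "real b \<le> real n / real m + 1"
    unfolding b_def using floor_divide_of_nat_eq[of n m, where 'a = real] by simp linarith
  have "2 * D < n"
  proof -
    have "real D * real n \<le> real D * (real b * real m)"
      using b_ge by (intro mult_left_mono) auto
    also have "\<dots> = real (b * D) * real m" by simp
    also have "\<dots> \<le> real q * real m" using Dq by (intro mult_right_mono) (simp_all only: of_nat_le_iff of_nat_0_le_iff)
    finally have "real D * real n * (2 * (real m + 1)) \<le> real q * real m * (2 * (real m + 1))"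
      by (intro mult_right_mono) auto
    also have "\<dots> \<le> real m * (real n * (real n - 1))"
      using mult_left_mono[OF q_le, of "real m"] by (simp add: mult_ac)
    finally have "real n * (real D * (2 * (real m + 1))) \<le> real n * (real m * (real n - 1))"
      by (simp add: mult_ac)
    then have "real D * (2 * (real m + 1)) \<le> real m * (real n - 1)" using npos by simp
    also have "\<dots> < (real m + 1) * real n" using mpos npos by (simp add: algebra_simps)
    finally have "(real m + 1) * (2 * real D) < (real m + 1) * real n" by (simp add: algebra_simps)
    then have "2 * real D < real n" using mpos by simp
    then show ?thesis by linarith
  qed
  moreover have "7 * real n / 6 \<le> 3 * real D + real D / real m + 7 * real m / 4 + 7"
  proof -
    have "q < b * (D + 1)"
      unfolding D_def using dividend_less_times_div[of b q] by (simp add: b_def)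
    then have "q + 1 \<le> b * (D + 1)" by simp
    then have "real (q + 1) \<le> real (b * (D + 1))" by (simp only: of_nat_le_iff)
    then have "real q + 1 \<le> real b * (real D + 1)" by (simp add: algebra_simps)
    also have "\<dots> \<le> (real n / real m + 1) * (real D + 1)"
      using b_le by (intro mult_right_mono) auto
    finally have q1: "(real q + 1) * real m \<le> (real n + real m) * (real D + 1)"
      using mpos by (simp add: field_simps)
    \<comment> \<open>Here \<open>(n + m) * (n - 1 - m) = n * (n - 1) - m * (m + 1)\<close>; this
      form exposes the factor \<open>n + m\<close> of \<open>q1\<close>, which is cancelled
      below.\<close>
    have "(real n + real m) * (real m * (real n - 1 - real m)) \<le> real m * (real n * (real n - 1))"
      using mpos by (simp add: algebra_simps)
    also have "\<dots> \<le> (real q + 1) * real m * (2 * (real m + 1))"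
      using mult_left_mono[OF less_imp_le[OF q_ge], of "real m"] by (simp add: mult_ac)
    also have "\<dots> \<le> (real n + real m) * (real D + 1) * (2 * (real m + 1))"
      using q1 by (intro mult_right_mono) auto
    finally have "(real n + real m) * (real m * (real n - 1 - real m))
        \<le> (real n + real m) * ((real D + 1) * (2 * (real m + 1)))" by (simp add: mult_ac)
    then have "real m * (real n - 1 - real m) \<le> (real D + 1) * (2 * (real m + 1))"
      using mpos npos by (simp add: mult_le_cancel_left)
    then have D_ge: "real m * real n / (2 * (real m + 1)) - real m / 2 - 1 \<le> real D"
      using mpos by (simp add: field_simps)
    \<comment> \<open>\<open>K\<close> is the main term of the lower bound for \<open>D\<close>
      multiplied by \<open>3 + 1 / m\<close>.\<close>
    define K where "K = (3 * real m + 1) / (2 * (real m + 1)) * real n"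
    have "7 / 6 * real n \<le> K"
      unfolding K_def using m by (intro mult_right_mono) (simp_all add: field_simps)
    moreover have "K - (3 * real m + 1) / 2 - 3 - 1 / real m \<le> 3 * real D + real D / real m"
    proof -
      have "K - (3 * real m + 1) / 2 - 3 - 1 / real m
          = (3 + 1 / real m) * (real m * real n / (2 * (real m + 1)) - real m / 2 - 1)"
        unfolding K_def using mpos by (simp add: divide_simps) (simp add: algebra_simps)
      also have "\<dots> \<le> (3 + 1 / real m) * real D"
        using D_ge mpos by (intro mult_left_mono) auto
      finally show ?thesis by (simp add: distrib_right)
    qed
    moreover have "1 / real m \<le> 1 / 2" using m by (simp add: field_simps)
    moreover have "real m \<ge> 2" using m by simp
    ultimately show ?thesis by argo
  qed
  ultimately show thesis using that Dq by (simp add: q_def E_def b_def)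
qed

section \<open>Colour counts in a copy of a tree\<close>

theorem proposition1p4:
  shows "\<exists>C::real. C > 0 \<and>
    (\<forall>r::nat. r \<ge> 3 \<longrightarrow>
      (\<exists>N::nat. \<forall>n \<ge> N. \<exists>c :: nat set \<Rightarrow> nat.
        balanced_colouring r (complete_ugraph n) c \<and>
        (\<forall>T :: nat ugraph.
          utree T \<and> card (uverts T) = n \<and> real (max_udegree T) \<ge> 23 * real n / 24 + C \<longrightarrow>
          (\<forall>H. ucopy H T (complete_ugraph n) \<longrightarrow>
            (\<exists>j \<in> {2..r}. colour_count c H 1 \<le> colour_count c H j)))))"
proof (intro exI[of _ "1::real"] conjI allI impI)
  show "(1::real) > 0" by simp
  fix r :: nat assume r: "r \<ge> 3"
  define m where "m = r - 1"
  have m: "m \<ge> 2" "r = m + 1" using r by (auto simp: m_def)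
  show "\<exists>N::nat. \<forall>n \<ge> N. \<exists>c :: nat set \<Rightarrow> nat.
        balanced_colouring r (complete_ugraph n) c \<and>
        (\<forall>T :: nat ugraph.
          utree T \<and> card (uverts T) = n \<and> real (max_udegree T) \<ge> 23 * real n / 24 + 1 \<longrightarrow>
          (\<forall>H. ucopy H T (complete_ugraph n) \<longrightarrow>
            (\<exists>j \<in> {2..r}. colour_count c H 1 \<le> colour_count c H j)))"
  \<comment> \<open>The aim is \<open>3 * D + D div m + 2 * \<Delta> \<ge> 3 * n\<close>. Since 7/6
    + 2 * 23/24 = 3 + 1/12, there is a surplus of \<open>n / 12\<close>. It must cover
    \<open>7 * m / 4 + 7\<close>, plus 1 for rounding \<open>D / m\<close> down, minus 2 from the
    constant 1 in the degree bound; \<open>n \<ge> 21 * m + 96\<close> gives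
    \<open>n / 12 \<ge> 7 * m / 4 + 8\<close>.\<close>
  proof (intro exI[of _ "21 * m + 96"] allI impI)
    fix n assume n: "n \<ge> 21 * m + 96"
    let ?K = "complete_ugraph n"
    obtain D where D: "2 * D < n" "(n div m + 1) * D \<le> (n * (n - 1) div 2) div (m + 1)"
      "7 * real n / 6 \<le> 3 * real D + real D / real m + 7 * real m / 4 + 7"
      using circulant_degree_choice[OF m(1) n] by blast
    have "m > 0" using m by simp
    obtain c where c: "balanced_colouring (m + 1) ?K c"
      and c1: "\<And>v. v < n \<Longrightarrow> card {e \<in> uedges ?K. v \<in> e \<and> c e = 1} + 2 * D \<le> n - 1"
      and cj: "\<And>v. v < n \<Longrightarrow> D + D div m \<le>
         card {e \<in> uedges ?K. v \<in> e \<and> c e = v mod m + 2} + 1"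
      using circulant_colouring[OF D(1) \<open>m > 0\<close> D(2)] by blast
    have "\<exists>j \<in> {2..r}. colour_count c H 1 \<le> colour_count c H j"
      if T: "utree T" "card (uverts T) = n" "real (max_udegree T) \<ge> 23 * real n / 24 + 1"
        and H: "ucopy H T ?K" for T H :: "nat ugraph"
    proof -
      have simpleT: "simple_ugraph T" and acycT: "\<nexists>p. ucycle T p" and neT: "uverts T \<noteq> {}"
        using T by (auto simp: utree_def uconnected_def)
      have finT: "finite (uverts T)" using simpleT by (simp add: simple_ugraph_def)
      have simpleH: "simple_ugraph H" and subH: "uverts H \<subseteq> uverts ?K" "uedges H \<subseteq> uedges ?K"
        using H by (auto simp: ucopy_def usubgraph_def)
      obtain f where f: "bij_betw f (uverts T) (uverts H)"
        "\<And>u v. u \<in> uverts T \<Longrightarrow> v \<in> uverts T \<Longrightarrow> uadj T u v \<longleftrightarrow> uadj H (f u) (f v)"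
        using H by (auto simp: ucopy_def uisomorphic_def)
      have "max_udegree T \<in> udegree T ` uverts T"
        unfolding max_udegree_def using finT neT by (intro Max_in) auto
      then obtain x where x: "x \<in> uverts T" "udegree T x = max_udegree T" by auto
      define v where "v = f x"
      have degv: "udegree H v = max_udegree T"
        using uisomorphic_uedges(2)[OF simpleT simpleH f x(1)] x by (simp add: v_def)
      have "v \<in> uverts H" using f(1) x by (auto simp: v_def bij_betw_def)
      then have v: "v < n" using subH by (auto simp: complete_ugraph_def)
      have "card (uedges H) = card (uedges T)"
        using uisomorphic_uedges(1)[OF simpleT simpleH f] by (simp add: bij_betw_same_card)
      then have "card (uedges H) + 1 \<le> n"
        using acyclic_card_uedges[OF simpleT neT acycT] T by simp
      \<comment> \<open>With the previous bound, neither of the truncated subtractions below falls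
        short of the true difference: the degree is at most \<open>card (uedges H)\<close>, which is
        at most \<open>n - 1\<close>.\<close>
      moreover have "udegree H v \<le> card (uedges H)"
        unfolding udegree_def using finite_uedges[OF simpleH] by (intro card_mono) auto
      moreover have "colour_count c H 1
          \<le> card {e \<in> uedges ?K. v \<in> e \<and> c e = 1} + (card (uedges H) - udegree H v)"
        by (rule colour_counts_near_star(1)[OF simpleH subH simple_complete_ugraph])
      moreover have "card {e \<in> uedges ?K. v \<in> e \<and> c e = v mod m + 2}
          \<le> colour_count c H (v mod m + 2) + (n - 1 - udegree H v)"
        using colour_counts_near_star(2)[OF simpleH subH simple_complete_ugraph]
          udegree_complete_ugraph[OF v] by metis
      \<comment> \<open>Colour 1 occurs at most \<open>(n - 1 - 2 * D) + (n - 1 - \<Delta>)\<close>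
        times in \<open>H\<close>, the colour of the class of \<open>v\<close> at least
        \<open>D + D div m - 1 - (n - 1 - \<Delta>)\<close> times.\<close>
      ultimately have main: "colour_count c H 1 + 3 * D + D div m + 2 * udegree H v
          \<le> colour_count c H (v mod m + 2) + 3 * n"
        using c1[OF v] cj[OF v] by linarith
      have "real D / real m \<le> real (D div m) + 1" using floor_divide_of_nat_eq[of D m, where 'a = real] by linarith
      then have "3 * real n \<le> 3 * real D + real (D div m) + 2 * real (udegree H v)"
        using D(3) T(3) n by (simp add: degv)
      then have "3 * n \<le> 3 * D + D div m + 2 * udegree H v" by linarith
      then have "colour_count c H 1 \<le> colour_count c H (v mod m + 2)" using main by linarith
      moreover have "v mod m + 2 \<in> {2..r}"
        using mod_less_divisor[OF \<open>m > 0\<close>, of v] m(2)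
        unfolding atLeastAtMost_iff by linarith
      ultimately show ?thesis by blast
    qed
    then show "\<exists>c. balanced_colouring r ?K c \<and>
        (\<forall>T :: nat ugraph.
          utree T \<and> card (uverts T) = n \<and> real (max_udegree T) \<ge> 23 * real n / 24 + 1 \<longrightarrow>
          (\<forall>H. ucopy H T ?K \<longrightarrow>
            (\<exists>j \<in> {2..r}. colour_count c H 1 \<le> colour_count c H j)))"
      using c m by (intro exI[of _ c]) blast
  qed
qed

end
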